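(* Let $(\tilde M^{2l+1},\phi,\xi,\eta,\tilde g)$ be an almost contact metric manifold. There does not exist a proper doubly warped product submanifold $M^n={}_{f_2}N_1\times_{f_1}N_2$ of $\tilde M^{2l+1}$ such that the characteristic vector field $\xi$ is either tangent to $N_1$ or tangent to $N_2$ (that is, $\xi|_{M}\in\Gamma(TN_1)$ or $\xi|_{M}\in\Gamma(TN_2)$).
   Context: An almost contact metric manifold $(\tilde M^{2l+1},\phi,\xi,\eta,\tilde g)$ is an odd-dimensional smooth manifold with a $(1,1)$ tensor field $\phi$, a vector field $\xi$ (the characteristic vector field), a $1$-form $\eta$ and a Riemannian metric $\tilde g$ satisfying $\phi^2=-I+\eta\otimes\xi$, $\phi\xi=0$, $\eta\circ\phi=0$, $\eta(\xi)=1$, $\eta(X)=\tilde g(X,\xi)$, $\tilde g(\phi X,\phi Y)=\tilde g(X,Y)-\eta(X)\eta(Y)$ for all vector fields $X,Y$. Let $(N_1,g_{N_1})$, $(N_2,g_{N_2})$ be Riemannian manifolds of positive dimension and $f_1>0$, $f_2>0$ smooth functions on $N_1$, $N_2$ respectively. The doubly warped product ${}_{f_2}N_1\times_{f_1}N_2$ is the manifold $N_1\times N_2$ with the Riemannian metric $f_2^2\,g_{N_1}+f_1^2\,g_{N_2}$ (functions and tensors being pulled back by the projections). It is proper if neither $f_1$ nor $f_2$ is constant. A doubly warped product submanifold of $\tilde M$ is a doubly warped product isometrically immersed in $\tilde M$. Vector fields on a factor $N_i$ are identified with their lifts to $N_1\times N_2$: the lift of $X\in\Gamma(TN_i)$ is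 the unique vector field on $N_1\times N_2$ which projects to $X$ on $N_i$ and to $0$ on the other factor. "$\xi$ is tangent to $N_i$" means that $\xi$ restricted to $M$ is an element of $\Gamma(TN_i)$ in this sense. *)

theory Defs
  imports "HOL-Analysis.Analysis"
begin

section \<open>Smooth maps between open subsets of Euclidean spaces\<close>

text \<open>For open \<^term>\<open>U\<close>, \<open>Ck_on k f U\<close> says that \<open>f\<close> is of class \<open>C\<^sup>k\<close> on \<open>U\<close>: every
  directional derivative \<open>x \<mapsto> Df(x) v\<close> is of class one less.\<close>

primrec Ck_on :: "nat \<Rightarrow> ('e::euclidean_space \<Rightarrow> 'f::euclidean_space) \<Rightarrow> 'e set \<Rightarrow> bool" where
  "Ck_on 0 f U \<longleftrightarrow> continuous_on U f"
| "Ck_on (Suc k) f U \<longleftrightarrow>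
     (\<forall>x\<in>U. f differentiable (at x)) \<and> (\<forall>v. Ck_on k (\<lambda>x. frechet_derivative f (at x) v) U)"

definition smooth_on :: "('e::euclidean_space \<Rightarrow> 'f::euclidean_space) \<Rightarrow> 'e set \<Rightarrow> bool" where
  "smooth_on f U \<longleftrightarrow> (\<forall>k. Ck_on k f U)"


section \<open>Smooth manifolds\<close>

text \<open>A chart is a pair \<open>(U, \<phi>)\<close> of its domain and its coordinate map; only the values of \<open>\<phi>\<close> on
  \<open>U\<close> matter. The atlas need not be maximal: it generates the smooth structure. A manifold of
  dimension \<open>n\<close> is modelled on a Euclidean space \<open>'e\<close> with \<open>DIM('e) = n\<close>; as \<open>DIM('e) > 0\<close>, all
  manifolds here have positive dimension. The points are \<open>topspace (space_of M)\<close>, an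
  arbitrary subset of the type \<open>'a\<close>.\<close>

type_synonym ('a, 'e) chart = "'a set \<times> ('a \<Rightarrow> 'e)"

record ('a, 'e) manifold =
  space_of :: "'a topology"
  atlas :: "('a, 'e) chart set"

abbreviation points :: "('a, 'e) manifold \<Rightarrow> 'a set" where
  "points M \<equiv> topspace (space_of M)"

locale smooth_manifold =
  fixes M :: "('a, 'e::euclidean_space) manifold"
  assumes Hausdorff: "Hausdorff_space (space_of M)"
    and second_countable: "second_countable (space_of M)"
    and chart_domain: "(U, \<phi>) \<in> atlas M \<Longrightarrow> openin (space_of M) U"
    and chart_image: "(U, \<phi>) \<in> atlas M \<Longrightarrow> open (\<phi> ` U)"
    and chart_homeo: "(U, \<phi>) \<in> atlas M \<Longrightarrow>
      homeomorphic_map (subtopology (space_of M) U) (top_of_set (\<phi> ` U)) \<phi>"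
    and charts_cover: "(\<Union>(U, \<phi>)\<in>atlas M. U) = points M"
    and charts_compatible: "(U, \<phi>) \<in> atlas M \<Longrightarrow> (V, \<psi>) \<in> atlas M \<Longrightarrow>
      smooth_on (\<psi> \<circ> inv_into U \<phi>) (\<phi> ` (U \<inter> V))"

definition smooth_functions :: "('a, 'e::euclidean_space) manifold \<Rightarrow> ('a \<Rightarrow> real) set" where
  "smooth_functions M = {h. \<forall>(U, \<phi>)\<in>atlas M. smooth_on (h \<circ> inv_into U \<phi>) (\<phi> ` U)}"

definition smooth_map ::
  "('a, 'e::euclidean_space) manifold \<Rightarrow> ('b, 'f::euclidean_space) manifold \<Rightarrow> ('a \<Rightarrow> 'b) \<Rightarrow> bool" where
  "smooth_map M N F \<longleftrightarrow>
     continuous_map (space_of M) (space_of N) F \<and>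
     (\<forall>(U, \<phi>)\<in>atlas M. \<forall>(V, \<psi>)\<in>atlas N.
        smooth_on (\<psi> \<circ> F \<circ> inv_into U \<phi>) (\<phi> ` (U \<inter> F -` V)))"

definition prod_manifold ::
  "('a, 'e) manifold \<Rightarrow> ('b, 'f) manifold \<Rightarrow> ('a \<times> 'b, 'e \<times> 'f) manifold" where
  "prod_manifold M N =
     \<lparr> space_of = prod_topology (space_of M) (space_of N),
       atlas = {(U \<times> V, map_prod \<phi> \<psi>) | U \<phi> V \<psi>. (U, \<phi>) \<in> atlas M \<and> (V, \<psi>) \<in> atlas N} \<rparr>"


section \<open>Tangent vectors, differentials and tensor fields\<close>

text \<open>Tangent vectors at \<open>p\<close> are the derivations at \<open>p\<close> of the algebra of smooth functions. They are
  made extensional (zero on functions that are not smooth), so that equality of tangent vectors is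
  equality of HOL functions; the zero vector is \<open>\<lambda>h. 0\<close>.\<close>

type_synonym 'a tangent_vector = "('a \<Rightarrow> real) \<Rightarrow> real"

definition tangent_space ::
  "('a, 'e::euclidean_space) manifold \<Rightarrow> 'a \<Rightarrow> 'a tangent_vector set" where
  "tangent_space M p = {v.
     (\<forall>h. h \<notin> smooth_functions M \<longrightarrow> v h = 0) \<and>
     (\<forall>h\<in>smooth_functions M. \<forall>k\<in>smooth_functions M. \<forall>a b.
        v (\<lambda>x. a * h x + b * k x) = a * v h + b * v k) \<and>
     (\<forall>h\<in>smooth_functions M. \<forall>k\<in>smooth_functions M.
        v (\<lambda>x. h x * k x) = h p * v k + k p * v h)}"

text \<open>\<open>differential N F\<close> is \<open>dF\<close> for a smooth map \<open>F\<close> into \<open>N\<close>: \<open>dF(v)(h) = v(h \<circ> F)\<close>. The base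
  point and the source manifold are implicit in \<open>v\<close>.\<close>

definition differential ::
  "('b, 'f::euclidean_space) manifold \<Rightarrow> ('a \<Rightarrow> 'b) \<Rightarrow> 'a tangent_vector \<Rightarrow> 'b tangent_vector" where
  "differential N F v = (\<lambda>h. if h \<in> smooth_functions N then v (h \<circ> F) else 0)"

definition vector_fields ::
  "('a, 'e::euclidean_space) manifold \<Rightarrow> ('a \<Rightarrow> 'a tangent_vector) set" where
  "vector_fields M = {X.
     (\<forall>p\<in>points M. X p \<in> tangent_space M p) \<and>
     (\<forall>h\<in>smooth_functions M. (\<lambda>p. X p h) \<in> smooth_functions M)}"

definition one_form ::
  "('a, 'e::euclidean_space) manifold \<Rightarrow> ('a \<Rightarrow> 'a tangent_vector \<Rightarrow> real) \<Rightarrow> bool" where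
  "one_form M \<eta> \<longleftrightarrow>
     (\<forall>p\<in>points M. \<forall>u\<in>tangent_space M p. \<forall>v\<in>tangent_space M p. \<forall>a b.
        \<eta> p (\<lambda>h. a * u h + b * v h) = a * \<eta> p u + b * \<eta> p v) \<and>
     (\<forall>X\<in>vector_fields M. (\<lambda>p. \<eta> p (X p)) \<in> smooth_functions M)"

definition tensor_field_1_1 ::
  "('a, 'e::euclidean_space) manifold \<Rightarrow> ('a \<Rightarrow> 'a tangent_vector \<Rightarrow> 'a tangent_vector) \<Rightarrow> bool" where
  "tensor_field_1_1 M \<Phi> \<longleftrightarrow>
     (\<forall>p\<in>points M. \<forall>u\<in>tangent_space M p. \<Phi> p u \<in> tangent_space M p) \<and>
     (\<forall>p\<in>points M. \<forall>u\<in>tangent_space M p. \<forall>v\<in>tangent_space M p. \<forall>a b.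
        \<Phi> p (\<lambda>h. a * u h + b * v h) = (\<lambda>h. a * \<Phi> p u h + b * \<Phi> p v h)) \<and>
     (\<forall>X\<in>vector_fields M. (\<lambda>p. \<Phi> p (X p)) \<in> vector_fields M)"

type_synonym 'a metric_tensor = "'a \<Rightarrow> 'a tangent_vector \<Rightarrow> 'a tangent_vector \<Rightarrow> real"

definition riemannian_metric ::
  "('a, 'e::euclidean_space) manifold \<Rightarrow> 'a metric_tensor \<Rightarrow> bool" where
  "riemannian_metric M g \<longleftrightarrow>
     (\<forall>p\<in>points M. \<forall>u\<in>tangent_space M p. \<forall>v\<in>tangent_space M p. g p u v = g p v u) \<and>
     (\<forall>p\<in>points M. \<forall>u\<in>tangent_space M p. \<forall>v\<in>tangent_space M p. \<forall>w\<in>tangent_space M p. \<forall>a b.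
        g p (\<lambda>h. a * u h + b * v h) w = a * g p u w + b * g p v w) \<and>
     (\<forall>p\<in>points M. \<forall>u\<in>tangent_space M p. u \<noteq> (\<lambda>h. 0) \<longrightarrow> g p u u > 0) \<and>
     (\<forall>X\<in>vector_fields M. \<forall>Y\<in>vector_fields M. (\<lambda>p. g p (X p) (Y p)) \<in> smooth_functions M)"

locale riemannian_manifold = smooth_manifold M
  for M :: "('a, 'e::euclidean_space) manifold" +
  fixes g :: "'a metric_tensor"
  assumes metric: "riemannian_metric M g"


section \<open>Almost contact metric manifolds\<close>

locale almost_contact_metric_manifold = riemannian_manifold M g
  for l :: nat and M :: "('a, 'e::euclidean_space) manifold"
    and \<phi> :: "'a \<Rightarrow> 'a tangent_vector \<Rightarrow> 'a tangent_vector"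
    and \<xi> :: "'a \<Rightarrow> 'a tangent_vector"
    and \<eta> :: "'a \<Rightarrow> 'a tangent_vector \<Rightarrow> real"
    and g :: "'a metric_tensor" +
  assumes dimension: "DIM('e) = 2 * l + 1"
    and \<phi>: "tensor_field_1_1 M \<phi>"
    and \<xi>: "\<xi> \<in> vector_fields M"
    and \<eta>: "one_form M \<eta>"
    and \<phi>_\<phi>: "X \<in> vector_fields M \<Longrightarrow> p \<in> points M \<Longrightarrow>
      \<phi> p (\<phi> p (X p)) = (\<lambda>h. - X p h + \<eta> p (X p) * \<xi> p h)"
    and \<phi>_\<xi>: "p \<in> points M \<Longrightarrow> \<phi> p (\<xi> p) = (\<lambda>h. 0)"
    and \<eta>_\<phi>: "X \<in> vector_fields M \<Longrightarrow> p \<in> points M \<Longrightarrow> \<eta> p (\<phi> p (X p)) = 0"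
    and \<eta>_\<xi>: "p \<in> points M \<Longrightarrow> \<eta> p (\<xi> p) = 1"
    and \<eta>_metric: "X \<in> vector_fields M \<Longrightarrow> p \<in> points M \<Longrightarrow> \<eta> p (X p) = g p (X p) (\<xi> p)"
    and \<phi>_metric: "X \<in> vector_fields M \<Longrightarrow> Y \<in> vector_fields M \<Longrightarrow> p \<in> points M \<Longrightarrow>
      g p (\<phi> p (X p)) (\<phi> p (Y p)) = g p (X p) (Y p) - \<eta> p (X p) * \<eta> p (Y p)"


section \<open>Doubly warped products and submanifolds\<close>

text \<open>The data of the doubly warped product \<open>\<^bsub>f\<^sub>2\<^esub>N\<^sub>1 \<times>\<^bsub>f\<^sub>1\<^esub> N\<^sub>2\<close>; note that \<open>f\<^sub>1\<close> lives on \<open>N\<^sub>1\<close> but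
  warps the metric of \<open>N\<^sub>2\<close>, and vice versa.\<close>

locale doubly_warped_product =
  N1: riemannian_manifold N1 g1 + N2: riemannian_manifold N2 g2
  for N1 :: "('a, 'e::euclidean_space) manifold" and g1 :: "'a metric_tensor" and f1 :: "'a \<Rightarrow> real"
    and N2 :: "('b, 'f::euclidean_space) manifold" and g2 :: "'b metric_tensor" and f2 :: "'b \<Rightarrow> real" +
  assumes f1_smooth: "f1 \<in> smooth_functions N1"
    and f1_pos: "p \<in> points N1 \<Longrightarrow> f1 p > 0"
    and f2_smooth: "f2 \<in> smooth_functions N2"
    and f2_pos: "q \<in> points N2 \<Longrightarrow> f2 q > 0"

locale proper_doubly_warped_product = doubly_warped_product +
  assumes f1_not_constant: "\<not> f1 constant_on points N1"
    and f2_not_constant: "\<not> f2 constant_on points N2"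

definition doubly_warped_metric ::
  "('a, 'e::euclidean_space) manifold \<Rightarrow> 'a metric_tensor \<Rightarrow> ('a \<Rightarrow> real) \<Rightarrow>
   ('b, 'f::euclidean_space) manifold \<Rightarrow> 'b metric_tensor \<Rightarrow> ('b \<Rightarrow> real) \<Rightarrow> ('a \<times> 'b) metric_tensor" where
  "doubly_warped_metric N1 g1 f1 N2 g2 f2 = (\<lambda>x u v.
     (f2 (snd x))\<^sup>2 * g1 (fst x) (differential N1 fst u) (differential N1 fst v) +
     (f1 (fst x))\<^sup>2 * g2 (snd x) (differential N2 snd u) (differential N2 snd v))"

definition isometric_immersion ::
  "('a, 'e::euclidean_space) manifold \<Rightarrow> 'a metric_tensor \<Rightarrow>
   ('b, 'f::euclidean_space) manifold \<Rightarrow> 'b metric_tensor \<Rightarrow> ('a \<Rightarrow> 'b) \<Rightarrow> bool" where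
  "isometric_immersion M g N g' F \<longleftrightarrow>
     smooth_map M N F \<and>
     (\<forall>p\<in>points M. inj_on (differential N F) (tangent_space M p)) \<and>
     (\<forall>p\<in>points M. \<forall>u\<in>tangent_space M p. \<forall>v\<in>tangent_space M p.
        g' (F p) (differential N F u) (differential N F v) = g p u v)"

text \<open>\<open>W\<close> is the lift to \<open>N\<^sub>1 \<times> N\<^sub>2\<close> of the vector field \<open>X\<close> on the first, respectively second,
  factor.\<close>

definition is_lift_fst ::
  "('a, 'e::euclidean_space) manifold \<Rightarrow> ('b, 'f::euclidean_space) manifold \<Rightarrow>
   ('a \<Rightarrow> 'a tangent_vector) \<Rightarrow> ('a \<times> 'b \<Rightarrow> ('a \<times> 'b) tangent_vector) \<Rightarrow> bool" where
  "is_lift_fst N1 N2 X W \<longleftrightarrow>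
     W \<in> vector_fields (prod_manifold N1 N2) \<and>
     (\<forall>x\<in>points (prod_manifold N1 N2).
        differential N1 fst (W x) = X (fst x) \<and> differential N2 snd (W x) = (\<lambda>h. 0))"

definition is_lift_snd ::
  "('a, 'e::euclidean_space) manifold \<Rightarrow> ('b, 'f::euclidean_space) manifold \<Rightarrow>
   ('b \<Rightarrow> 'b tangent_vector) \<Rightarrow> ('a \<times> 'b \<Rightarrow> ('a \<times> 'b) tangent_vector) \<Rightarrow> bool" where
  "is_lift_snd N1 N2 X W \<longleftrightarrow>
     W \<in> vector_fields (prod_manifold N1 N2) \<and>
     (\<forall>x\<in>points (prod_manifold N1 N2).
        differential N1 fst (W x) = (\<lambda>h. 0) \<and> differential N2 snd (W x) = X (snd x))"

text \<open>For an immersion \<open>F\<close> of \<open>N\<^sub>1 \<times> N\<^sub>2\<close> into \<open>M\<close>, a vector field \<open>\<xi>\<close> of \<open>M\<close> restricted along \<open>F\<close>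
  is an element of \<open>\<Gamma>(TN\<^sub>1)\<close>, respectively \<open>\<Gamma>(TN\<^sub>2)\<close>.\<close>

definition tangent_to_fst ::
  "('a, 'e::euclidean_space) manifold \<Rightarrow> ('b, 'f::euclidean_space) manifold \<Rightarrow>
   ('c, 'k::euclidean_space) manifold \<Rightarrow> ('a \<times> 'b \<Rightarrow> 'c) \<Rightarrow> ('c \<Rightarrow> 'c tangent_vector) \<Rightarrow> bool" where
  "tangent_to_fst N1 N2 M F \<xi> \<longleftrightarrow>
     (\<exists>X\<in>vector_fields N1. \<exists>W. is_lift_fst N1 N2 X W \<and>
        (\<forall>x\<in>points (prod_manifold N1 N2). \<xi> (F x) = differential M F (W x)))"

definition tangent_to_snd ::
  "('a, 'e::euclidean_space) manifold \<Rightarrow> ('b, 'f::euclidean_space) manifold \<Rightarrow>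
   ('c, 'k::euclidean_space) manifold \<Rightarrow> ('a \<times> 'b \<Rightarrow> 'c) \<Rightarrow> ('c \<Rightarrow> 'c tangent_vector) \<Rightarrow> bool" where
  "tangent_to_snd N1 N2 M F \<xi> \<longleftrightarrow>
     (\<exists>X\<in>vector_fields N2. \<exists>W. is_lift_snd N1 N2 X W \<and>
        (\<forall>x\<in>points (prod_manifold N1 N2). \<xi> (F x) = differential M F (W x)))"

end

theory Submission
  imports Defs
begin

text \<open>
  The characteristic vector field has unit length, because
  \<open>g(\<xi>, \<xi>) = \<eta>(\<xi>) = 1\<close>. If its restriction to \<open>N\<^sub>1 \<times> N\<^sub>2\<close> is the lift of a vector field \<open>X\<close> on \<open>N\<^sub>1\<close>,
  the isometry turns this into
  \<open>f\<^sub>2(q)\<^sup>2 g\<^sub>1(X, X)(p) = 1\<close> for all \<open>p \<in> N\<^sub>1\<close> and \<open>q \<in> N\<^sub>2\<close>. For a fixed \<open>p\<close> the second factor on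
  the left does not depend on \<open>q\<close>, so the positive function \<open>f\<^sub>2\<close> is constant and the product is not
  proper (lemma \<open>unit_field_tangent_to_fst_imp_constant\<close>). If \<open>\<xi>\<close> is tangent to \<open>N\<^sub>2\<close>, the same
  argument makes \<open>f\<^sub>1\<close> constant (lemma \<open>unit_field_tangent_to_snd_imp_constant\<close>).
\<close>

lemma zero_in_tangent_space: "(\<lambda>h. 0) \<in> tangent_space M p"
  by (simp add: tangent_space_def)

lemma (in riemannian_manifold) metric_zero_left:
  assumes "p \<in> points M" and "w \<in> tangent_space M p"
  shows "g p (\<lambda>h. 0) w = 0"
proof -
  have "g p (\<lambda>h. a * u h + b * v h) w = a * g p u w + b * g p v w"
    if "u \<in> tangent_space M p" "v \<in> tangent_space M p" for u v a b
    using metric assms that by (simp add: riemannian_metric_def)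
  from this[OF zero_in_tangent_space zero_in_tangent_space, of 0 0] show ?thesis
    by simp
qed

lemma (in almost_contact_metric_manifold) characteristic_field_unit:
  assumes "p \<in> points M"
  shows "g p (\<xi> p) (\<xi> p) = 1"
  using \<eta>_metric[OF \<xi> assms] \<eta>_\<xi>[OF assms] by simp

text \<open>Each value of a positive function \<open>f\<close> is determined by the number \<open>c\<close>, as \<open>1 / \<surd>c\<close>.\<close>

lemma constant_on_if_square_times_eq_1:
  fixes f :: "'b \<Rightarrow> real"
  assumes pos: "\<And>q. q \<in> S \<Longrightarrow> f q > 0"
    and eq: "\<And>q. q \<in> S \<Longrightarrow> (f q)\<^sup>2 * c = 1"
  shows "f constant_on S"
proof -
  have "f q = sqrt (1 / c)" if "q \<in> S" for q
  proof -
    have "c \<noteq> 0"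
      using eq[OF that] by auto
    then have "(f q)\<^sup>2 = 1 / c"
      using eq[OF that] by (simp add: field_simps)
    then show ?thesis
      using pos[OF that] by (metis less_imp_le real_sqrt_unique)
  qed
  then show ?thesis
    by (auto simp: constant_on_def)
qed

text \<open>This moves the unit length of \<open>\<xi>\<close> to the domain, where the warped metric can be evaluated on the
  lift \<open>W\<close>.\<close>

lemma isometric_immersion_unit_field:
  assumes "isometric_immersion P h M g F"
    and unit: "\<And>y. y \<in> points M \<Longrightarrow> g y (\<xi> y) (\<xi> y) = 1"
    and "W \<in> vector_fields P" and "x \<in> points P"
    and "\<xi> (F x) = differential M F (W x)"
  shows "h x (W x) (W x) = 1"
proof -
  have "W x \<in> tangent_space P x"
    using assms(3,4) by (simp add: vector_fields_def)
  then have "h x (W x) (W x) = g (F x) (\<xi> (F x)) (\<xi> (F x))"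
    using assms(1,4,5) by (simp add: isometric_immersion_def)
  moreover have "F x \<in> points M"
    using assms(1,4) by (auto simp: isometric_immersion_def smooth_map_def continuous_map_def)
  ultimately show ?thesis
    using unit by simp
qed

context doubly_warped_product
begin

lemma unit_field_tangent_to_fst_imp_constant:
  assumes iso: "isometric_immersion (prod_manifold N1 N2)
      (doubly_warped_metric N1 g1 f1 N2 g2 f2) M g F"
    and unit: "\<And>y. y \<in> points M \<Longrightarrow> g y (\<xi> y) (\<xi> y) = 1"
    and tangent: "tangent_to_fst N1 N2 M F \<xi>"
    and "points N1 \<noteq> {}"
  shows "f2 constant_on points N2"
proof -
  obtain p where p: "p \<in> points N1"
    using assms(4) by blast
  obtain X W where lift: "is_lift_fst N1 N2 X W"
    and \<xi>: "\<And>x. x \<in> points (prod_manifold N1 N2) \<Longrightarrow> \<xi> (F x) = differential M F (W x)"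
    using tangent by (auto simp: tangent_to_fst_def)
  have "(f2 q)\<^sup>2 * g1 p (X p) (X p) = 1" if q: "q \<in> points N2" for q
  proof -
    have x: "(p, q) \<in> points (prod_manifold N1 N2)"
      using p q by (simp add: prod_manifold_def)
    have "W \<in> vector_fields (prod_manifold N1 N2)"
      using lift by (simp add: is_lift_fst_def)
    from isometric_immersion_unit_field[where g = g and \<xi> = \<xi>, OF iso unit this x \<xi>[OF x]]
    have "doubly_warped_metric N1 g1 f1 N2 g2 f2 (p, q) (W (p, q)) (W (p, q)) = 1" .
    then show ?thesis
      using lift x N2.metric_zero_left[OF q zero_in_tangent_space]
      by (simp add: is_lift_fst_def doubly_warped_metric_def)
  qed
  then show ?thesis
    using f2_pos by (rule constant_on_if_square_times_eq_1[rotated])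
qed

lemma unit_field_tangent_to_snd_imp_constant:
  assumes iso: "isometric_immersion (prod_manifold N1 N2)
      (doubly_warped_metric N1 g1 f1 N2 g2 f2) M g F"
    and unit: "\<And>y. y \<in> points M \<Longrightarrow> g y (\<xi> y) (\<xi> y) = 1"
    and tangent: "tangent_to_snd N1 N2 M F \<xi>"
    and "points N2 \<noteq> {}"
  shows "f1 constant_on points N1"
proof -
  obtain q where q: "q \<in> points N2"
    using assms(4) by blast
  obtain X W where lift: "is_lift_snd N1 N2 X W"
    and \<xi>: "\<And>x. x \<in> points (prod_manifold N1 N2) \<Longrightarrow> \<xi> (F x) = differential M F (W x)"
    using tangent by (auto simp: tangent_to_snd_def)
  have "(f1 p)\<^sup>2 * g2 q (X q) (X q) = 1" if p: "p \<in> points N1" for p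
  proof -
    have x: "(p, q) \<in> points (prod_manifold N1 N2)"
      using p q by (simp add: prod_manifold_def)
    have "W \<in> vector_fields (prod_manifold N1 N2)"
      using lift by (simp add: is_lift_snd_def)
    from isometric_immersion_unit_field[where g = g and \<xi> = \<xi>, OF iso unit this x \<xi>[OF x]]
    have "doubly_warped_metric N1 g1 f1 N2 g2 f2 (p, q) (W (p, q)) (W (p, q)) = 1" .
    then show ?thesis
      using lift x N1.metric_zero_left[OF p zero_in_tangent_space]
      by (simp add: is_lift_snd_def doubly_warped_metric_def)
  qed
  then show ?thesis
    using f1_pos by (rule constant_on_if_square_times_eq_1[rotated])
qed

end

theorem theorem4p1:
  fixes l :: nat
    and M :: "('m, 'k::euclidean_space) manifold"
    and \<phi> :: "'m \<Rightarrow> 'm tangent_vector \<Rightarrow> 'm tangent_vector"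
    and \<xi> :: "'m \<Rightarrow> 'm tangent_vector"
    and \<eta> :: "'m \<Rightarrow> 'm tangent_vector \<Rightarrow> real"
    and g :: "'m metric_tensor"
  assumes "almost_contact_metric_manifold l M \<phi> \<xi> \<eta> g"
  shows "\<not> (\<exists>(N1 :: ('a, 'e::euclidean_space) manifold) g1 f1
             (N2 :: ('b, 'f::euclidean_space) manifold) g2 f2 F.
           proper_doubly_warped_product N1 g1 f1 N2 g2 f2 \<and>
           isometric_immersion (prod_manifold N1 N2)
             (doubly_warped_metric N1 g1 f1 N2 g2 f2) M g F \<and>
           (tangent_to_fst N1 N2 M F \<xi> \<or> tangent_to_snd N1 N2 M F \<xi>))"
proof (intro notI, elim exE conjE)
  fix N1 :: "('a, 'e) manifold" and g1 f1 and N2 :: "('b, 'f) manifold" and g2 f2 F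
  assume "proper_doubly_warped_product N1 g1 f1 N2 g2 f2"
    and iso: "isometric_immersion (prod_manifold N1 N2)
      (doubly_warped_metric N1 g1 f1 N2 g2 f2) M g F"
    and tangent: "tangent_to_fst N1 N2 M F \<xi> \<or> tangent_to_snd N1 N2 M F \<xi>"
  then interpret proper_doubly_warped_product N1 g1 f1 N2 g2 f2
    by simp
  note unit = almost_contact_metric_manifold.characteristic_field_unit[OF assms]
  \<comment> \<open>A function is constant on the empty set, so properness makes both factors nonempty.\<close>
  have nonempty: "points N1 \<noteq> {}" "points N2 \<noteq> {}"
    using f1_not_constant f2_not_constant by (auto simp: constant_on_def)
  from tangent show False
  proof
    assume "tangent_to_fst N1 N2 M F \<xi>"
    from unit_field_tangent_to_fst_imp_constant[where g = g and \<xi> = \<xi>, OF iso unit this nonempty(1)]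
    show False
      using f2_not_constant by contradiction
  next
    assume "tangent_to_snd N1 N2 M F \<xi>"
    from unit_field_tangent_to_snd_imp_constant[where g = g and \<xi> = \<xi>, OF iso unit this nonempty(2)]
    show False
      using f1_not_constant by contradiction
  qed
qed

end
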